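(* For every graphon $W:\Omega\times\Omega\to[0,1]$ on an atomless Borel probability space $(\Omega,\nu)$ we have $\omega_{\mathrm{frac}}(W)\le\chi_{\mathrm{frac}}(W)$.
   Context: A graphon is a symmetric measurable $W:\Omega\times\Omega\to[0,1]$. A measurable set $A$ is independent in $W$ if $W=0$ a.e. on $A\times A$; $\mathcal I(W)$ is the set of independent sets and $\mathcal I_x(W)$ those containing $x$. A fractional clique of $W$ is a measurable $f:\Omega\to[0,\infty)$ with $\int_I f\le1$ for every $I\in\mathcal I(W)$, and $\omega_{\mathrm{frac}}(W)=\sup\int_\Omega f$ over fractional cliques. A fractional coloring of $W$ is $c:\mathcal I(W)\to[0,1]$ with $\sum_{I\in\mathcal I_x(W)}c(I)\ge1$ for almost every $x$; $\chi_{\mathrm{frac}}(W)$ is the infimum of $\sum_{I\in\mathcal I(W)}c(I)$ over fractional colorings. *)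

theory Defs
  imports "HOL-Analysis.Analysis" "HOL-Probability.Probability_Measure"
begin

text \<open>
  Borel spaces are understood as standard Borel spaces: the measurable sets are the Borel sets
  of some Polish (separable, completely metrizable) topology on the underlying set.
\<close>

definition standard_borel_space :: "'a measure \<Rightarrow> bool" where
  "standard_borel_space M \<longleftrightarrow>
     (\<exists>X. topspace X = space M \<and> completely_metrizable_space X \<and> second_countable X \<and>
          sets M = sigma_sets (topspace X) {U. openin X U})"

definition atomless :: "'a measure \<Rightarrow> bool" where
  "atomless M \<longleftrightarrow>
     (\<forall>A\<in>sets M. 0 < emeasure M A \<longrightarrow>
        (\<exists>B\<in>sets M. B \<subseteq> A \<and> 0 < emeasure M B \<and> emeasure M B < emeasure M A))"

definition graphon :: "'a measure \<Rightarrow> ('a \<times> 'a \<Rightarrow> real) \<Rightarrow> bool" where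
  "graphon M W \<longleftrightarrow>
     W \<in> borel_measurable (M \<Otimes>\<^sub>M M) \<and>
     (\<forall>x\<in>space M. \<forall>y\<in>space M. W (x, y) = W (y, x) \<and> 0 \<le> W (x, y) \<and> W (x, y) \<le> 1)"

text \<open>
  Independent sets are honest measurable sets; sets differing by a null set are not identified.
\<close>

definition independent_sets :: "'a measure \<Rightarrow> ('a \<times> 'a \<Rightarrow> real) \<Rightarrow> 'a set set" where
  "independent_sets M W = {A \<in> sets M. AE p in M \<Otimes>\<^sub>M M. p \<in> A \<times> A \<longrightarrow> W p = 0}"

definition independent_sets_at :: "'a measure \<Rightarrow> ('a \<times> 'a \<Rightarrow> real) \<Rightarrow> 'a \<Rightarrow> 'a set set" where
  "independent_sets_at M W x = {A \<in> independent_sets M W. x \<in> A}"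

definition fractional_clique :: "'a measure \<Rightarrow> ('a \<times> 'a \<Rightarrow> real) \<Rightarrow> ('a \<Rightarrow> real) \<Rightarrow> bool" where
  "fractional_clique M W f \<longleftrightarrow>
     f \<in> borel_measurable M \<and> (\<forall>x\<in>space M. 0 \<le> f x) \<and>
     (\<forall>I\<in>independent_sets M W. (\<integral>\<^sup>+x\<in>I. ennreal (f x) \<partial>M) \<le> 1)"

definition frac_clique_number :: "'a measure \<Rightarrow> ('a \<times> 'a \<Rightarrow> real) \<Rightarrow> ennreal" where
  "frac_clique_number M W =
     (SUP f\<in>{f. fractional_clique M W f}. \<integral>\<^sup>+x. ennreal (f x) \<partial>M)"

text \<open>
  The families of independent sets are in general uncountable. The sums over them are unordered
  sums in the extended nonnegative reals, hence always defined: they are the suprema of the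
  finite partial sums, possibly infinite.
\<close>

definition fractional_coloring ::
    "'a measure \<Rightarrow> ('a \<times> 'a \<Rightarrow> real) \<Rightarrow> ('a set \<Rightarrow> real) \<Rightarrow> bool" where
  "fractional_coloring M W c \<longleftrightarrow>
     (\<forall>I\<in>independent_sets M W. 0 \<le> c I \<and> c I \<le> 1) \<and>
     (AE x in M. (\<Sum>\<^sub>\<infinity>I\<in>independent_sets_at M W x. ennreal (c I)) \<ge> 1)"

definition frac_chromatic_number :: "'a measure \<Rightarrow> ('a \<times> 'a \<Rightarrow> real) \<Rightarrow> ennreal" where
  "frac_chromatic_number M W =
     (INF c\<in>{c. fractional_coloring M W c}. \<Sum>\<^sub>\<infinity>I\<in>independent_sets M W. ennreal (c I))"

end

(* Weak duality of linear programs: for a fractional clique f and a fractional coloring c of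
   finite total weight, the total weight of c over the independent sets through almost every point
   is at least 1, so integrating f against this weight and exchanging sum and integral bounds the
   integral of f by the total weight of c. The exchange is legitimate because a finite total weight
   forces c to vanish outside a countable family. *)
theory Submission
  imports Defs
begin

text \<open>For each \<open>n\<close>, only finitely many terms can be at least 1/(n+1), since
  infinitely many would make the sum infinite. The support is the union of these finite
  sets.\<close>

lemma infsum_ennreal_countable_support:
  fixes f :: "'b \<Rightarrow> ennreal"
  assumes "infsum f A \<noteq> top"
  shows "countable {x \<in> A. f x \<noteq> 0}"
proof -
  let ?B = "\<lambda>n. {x \<in> A. ennreal (inverse (real (Suc n))) \<le> f x}"
  have "finite (?B n)" for n
  proof (rule ccontr)
    assume "infinite (?B n)"
    then have "infsum f (?B n) = \<infinity>"
      by (intro infsum_superconst_infinite_ennreal[where b = "ennreal (inverse (real (Suc n)))"])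
        (auto simp del: of_nat_Suc)
    moreover have "infsum f (?B n) \<le> infsum f A"
      by (rule infsum_mono_neutral) (auto intro: nonneg_summable_on_complete)
    ultimately show False
      using assms by (simp add: top_unique)
  qed
  then have "countable (\<Union>n. ?B n)"
    by (simp add: uncountable_infinite countable_finite)
  moreover have "{x \<in> A. f x \<noteq> 0} \<subseteq> (\<Union>n. ?B n)"
  proof
    fix x assume x: "x \<in> {x \<in> A. f x \<noteq> 0}"
    show "x \<in> (\<Union>n. ?B n)"
    \<comment> \<open>A finite nonzero value exceeds some threshold by the Archimedean property; the
      value \<open>top\<close> lies above all of them.\<close>
    proof (cases "f x")
      case (real r)
      with x have "0 < r"
        by (auto simp: less_le)
      then obtain n where "inverse (real (Suc n)) < r"
        using reals_Archimedean by blast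
      then show ?thesis
        using x real by (auto intro!: exI[of _ n] ennreal_leI simp del: of_nat_Suc)
    qed (use x in auto)
  qed
  ultimately show ?thesis
    by (rule countable_subset[rotated])
qed

text \<open>This makes integral exchange theorems available for unordered sums. In the infinite
  case, an enumeration of \<open>A\<close> turns both sides into the same series.\<close>

lemma infsum_ennreal_eq_nn_integral_count_space:
  fixes f :: "'b \<Rightarrow> ennreal"
  assumes "countable A"
  shows "infsum f A = (\<integral>\<^sup>+x. f x \<partial>count_space A)"
proof (cases "finite A")
  case True
  then show ?thesis
    by (simp add: nn_integral_count_space_finite)
next
  case False
  define g where "g = from_nat_into A"
  have bij: "bij_betw g UNIV A"
    unfolding g_def using assms False by (rule bij_betw_from_nat_into)
  have "infsum f A = infsum (\<lambda>n. f (g n)) UNIV"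
    by (rule infsum_reindex_bij_betw[OF bij, symmetric])
  also have "\<dots> = (\<Sum>n. f (g n))"
    by (intro sums_unique has_sum_imp_sums has_sum_infsum nonneg_summable_on_complete) simp
  also have "\<dots> = (\<integral>\<^sup>+n. f (g n) \<partial>count_space UNIV)"
    by (rule nn_integral_count_space_nat[symmetric])
  also have "\<dots> = (\<integral>\<^sup>+x. f x \<partial>count_space A)"
    by (rule nn_integral_bij_count_space[OF bij])
  finally show ?thesis .
qed

lemma fractional_clique_integral_le_coloring_weight:
  assumes clique: "fractional_clique M W f" and coloring: "fractional_coloring M W c"
  shows "(\<integral>\<^sup>+x. ennreal (f x) \<partial>M) \<le> (\<Sum>\<^sub>\<infinity>I\<in>independent_sets M W. ennreal (c I))"
proof (cases "(\<Sum>\<^sub>\<infinity>I\<in>independent_sets M W. ennreal (c I)) = top")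
  \<comment> \<open>Infinite total weight makes the bound trivial. Otherwise the support
    \<open>J\<close> of the weights is countable.\<close>
  case False
  define J where "J = {I \<in> independent_sets M W. ennreal (c I) \<noteq> 0}"
  have J: "countable J"
    unfolding J_def using False by (rule infsum_ennreal_countable_support)
  have J_sets [measurable]: "I \<in> sets M" if "I \<in> J" for I
    using that by (simp add: J_def independent_sets_def)
  have [measurable]: "f \<in> borel_measurable M"
    using clique by (simp add: fractional_clique_def)
  have f_le: "(\<integral>\<^sup>+x\<in>I. ennreal (f x) \<partial>M) \<le> 1" if "I \<in> J" for I
    using clique that by (simp add: fractional_clique_def J_def)
  \<comment> \<open>The index family on the left varies with \<open>x\<close>. Moving that
    dependence into an indicator leaves the fixed countable index set \<open>J\<close>.\<close>
  have through: "(\<Sum>\<^sub>\<infinity>I\<in>independent_sets_at M W x. ennreal (c I)) =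
      (\<integral>\<^sup>+I. ennreal (c I) * indicator I x \<partial>count_space J)" for x
  proof -
    have "(\<Sum>\<^sub>\<infinity>I\<in>independent_sets_at M W x. ennreal (c I)) =
        (\<Sum>\<^sub>\<infinity>I\<in>J. ennreal (c I) * indicator I x)"
      by (rule infsum_cong_neutral)
        (auto simp: J_def independent_sets_at_def indicator_def)
    then show ?thesis
      by (simp add: infsum_ennreal_eq_nn_integral_count_space[OF J])
  qed
  have "AE x in M. 1 \<le> (\<integral>\<^sup>+I. ennreal (c I) * indicator I x \<partial>count_space J)"
    using coloring by (simp add: fractional_coloring_def through)
  then have "(\<integral>\<^sup>+x. ennreal (f x) \<partial>M) \<le>
      (\<integral>\<^sup>+x. ennreal (f x) * (\<integral>\<^sup>+I. ennreal (c I) * indicator I x \<partial>count_space J) \<partial>M)"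
    by (intro nn_integral_mono_AE) (auto elim!: eventually_mono dest: mult_left_mono)
  also have "\<dots> =
      (\<integral>\<^sup>+x. (\<integral>\<^sup>+I. ennreal (c I) * (ennreal (f x) * indicator I x) \<partial>count_space J) \<partial>M)"
    by (simp add: nn_integral_cmult[symmetric] mult.left_commute)
  \<comment> \<open>Tonelli for a countable index set: each integrand is nonnegative and measurable
    in \<open>x\<close>.\<close>
  also have "\<dots> =
      (\<integral>\<^sup>+I. (\<integral>\<^sup>+x. ennreal (c I) * (ennreal (f x) * indicator I x) \<partial>M) \<partial>count_space J)"
    by (rule nn_integral_count_space_nn_integral[OF J]) measurable
  also have "\<dots> = (\<integral>\<^sup>+I. ennreal (c I) * (\<integral>\<^sup>+x\<in>I. ennreal (f x) \<partial>M) \<partial>count_space J)"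
    by (intro nn_integral_cong nn_integral_cmult) simp
  \<comment> \<open>The clique condition bounds each inner integral by 1.\<close>
  also have "\<dots> \<le> (\<integral>\<^sup>+I. ennreal (c I) \<partial>count_space J)"
    using mult_left_mono[OF f_le] by (intro nn_integral_mono) fastforce
  also have "\<dots> = (\<Sum>\<^sub>\<infinity>I\<in>J. ennreal (c I))"
    by (rule infsum_ennreal_eq_nn_integral_count_space[OF J, symmetric])
  also have "\<dots> \<le> (\<Sum>\<^sub>\<infinity>I\<in>independent_sets M W. ennreal (c I))"
    by (rule infsum_mono_neutral) (auto simp: J_def intro: nonneg_summable_on_complete)
  finally show ?thesis .
qed simp

theorem theorem6p1:
  fixes M :: "'a measure" and W :: "'a \<times> 'a \<Rightarrow> real"
  assumes "prob_space M"
    and "standard_borel_space M"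
    and "atomless M"
    and "graphon M W"
  shows "frac_clique_number M W \<le> frac_chromatic_number M W"
  \<comment> \<open>The bound holds for every pair of a clique and a coloring, so it passes to the
    supremum and the infimum.\<close>
  unfolding frac_clique_number_def frac_chromatic_number_def
  by (auto intro!: SUP_least INF_greatest fractional_clique_integral_le_coloring_weight)

end
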